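(* Consider the static attribute optimization problem under the multinomial logit model, $(\mathsf{SP}_1)$, in the real variables $d=(d_j)_{j\in\mathcal J}$, $x=(x_{jk})_{j\in\mathcal J,k\in\mathcal K_j}$: $$\max_{d,x}\ \sum_{j\in\mathcal J}\Big(\sum_{k\in\mathcal K_j}\phi_k x_{jk}-\psi_j\Big)d_j$$ subject to $$d_j=\frac{\exp(-\sum_{k\in\mathcal K_j}x_{jk})}{1+\sum_{j'\in\mathcal J}\exp(-\sum_{k\in\mathcal K_{j'}}x_{j'k})}\quad\forall j\in\mathcal J,$$ $x_{jk}\ge\underline x_{jk}$ for all $j\in\mathcal J$, $k\in\underline{\mathcal K}_j$, and $x_{jk}\le\overline x_{jk}$ for all $j\in\mathcal J$, $k\in\overline{\mathcal K}_j$. Consider also the convex conic program $(\mathsf{SP}_5)$ in the real variables $d=(d_j)_{j\in\mathcal J}$, $d_0$, $u=(u_{jk})_{j\in\mathcal J,k\in\mathcal K_j}$: $$\max_{d,d_0,u}\ \sum_{j\in\mathcal J}\Big(\sum_{k\in\mathcal K_j}\phi_k u_{jk}-\psi_j d_j\Big)$$ subject to $(d_0,d_j,\sum_{k\in\mathcal K_j}u_{jk})\in\mathcal K_{\exp}$ for all $j\in\mathcal J$; $(d_j,d_0,-\sum_{k\in\mathcal K_j}\overline x_{jk}d_0)\in\mathcal K_{\exp}$ for all $j\in\overline{\mathcal J}$; $u_{jk}\ge\underline x_{jk}d_j$ for all $j\in\mathcal J$, $k\in\underline{\mathcal K}_j$; $u_{jk}\le\overline x_{jk}d_j$ for all $j\in\mathcal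 J$, $k\in\overline{\mathcal K}_j$; $d_0+\sum_{j\in\mathcal J}d_j=1$. Then $(\mathsf{SP}_1)$ has an optimal solution if and only if for each $j\in\mathcal J$, and for all $k_1\in\mathcal K_j\setminus\overline{\mathcal K}_j$, $k_2\in\mathcal K_j\setminus\underline{\mathcal K}_j$, it holds that $\phi_{k_1}\le\phi_{k_2}$, in which case an optimal solution can be found by solving the convex conic program $(\mathsf{SP}_5)$. Otherwise, $(\mathsf{SP}_1)$ is unbounded.
   Context: $\mathcal J$ is a finite nonempty set (products). For each $j\in\mathcal J$, $\mathcal K_j$ is a finite nonempty set (attributes of product $j$); the sets $\mathcal K_j$ may overlap, and $\mathcal K=\bigcup_{j}\mathcal K_j$. $\underline{\mathcal K}_j\subseteq\mathcal K_j$ is the set of attributes having a lower bound $\underline x_{jk}\in\mathbb R$ for product $j$, and $\overline{\mathcal K}_j\subseteq\mathcal K_j$ the set of attributes having an upper bound $\overline x_{jk}\in\mathbb R$; $\underline x_{jk}\le\overline x_{jk}$ for $k\in\underline{\mathcal K}_j\cap\overline{\mathcal K}_j$. $\overline{\mathcal J}:=\{j\in\mathcal J:\overline{\mathcal K}_j=\mathcal K_j\}$. The parameters satisfy $\phi_k>0$ for all $k\in\mathcal K$ and $\psi_j\in\mathbb R$ for all $j\in\mathcal J$. The exponential cone is $$\mathcal K_{\exp}:=\{(a_1,a_2,a_3): a_3\le a_2\ln(a_1/a_2),\ a_1>0,\ a_2>0\}\cup\{(a_1,0,a_3): a_1\ge0,\ a_3\le0\}\subset\mathbb R^3.$$ A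 maximization problem is "unbounded" if it is feasible and its objective is not bounded above on the feasible set. *)

theory Defs
  imports "HOL-Analysis.Analysis"
begin

text \<open>
  Maximization problems are given by a feasible set and an objective function.
\<close>

definition is_optimal :: "'a set \<Rightarrow> ('a \<Rightarrow> real) \<Rightarrow> 'a \<Rightarrow> bool" where
  "is_optimal F f s \<longleftrightarrow> s \<in> F \<and> (\<forall>t\<in>F. f t \<le> f s)"

definition unbounded_problem :: "'a set \<Rightarrow> ('a \<Rightarrow> real) \<Rightarrow> bool" where
  "unbounded_problem F f \<longleftrightarrow> F \<noteq> {} \<and> \<not> bdd_above (f ` F)"

definition exp_cone :: "(real \<times> real \<times> real) set" where
  "exp_cone =
     {(a1, a2, a3). a3 \<le> a2 * ln (a1 / a2) \<and> a1 > 0 \<and> a2 > 0} \<union>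
     {(a1, a2, a3). a2 = 0 \<and> a1 \<ge> 0 \<and> a3 \<le> 0}"

text \<open>
  \<open>J\<close> is the set of products and \<open>K j\<close> the set of attributes of product \<open>j\<close>;
  \<open>KL j\<close> and \<open>KU j\<close> are the attributes with a lower bound \<open>xl j k\<close> and an
  upper bound \<open>xu j k\<close>, respectively. Decision variables are total functions; only
  their values at \<open>j \<in> J\<close> and \<open>k \<in> K j\<close> enter the constraints and objectives.
\<close>

definition fully_upper_bounded :: "'j set \<Rightarrow> ('j \<Rightarrow> 'k set) \<Rightarrow> ('j \<Rightarrow> 'k set) \<Rightarrow> 'j set" where
  "fully_upper_bounded J K KU = {j \<in> J. KU j = K j}"

definition SP1_feasible ::
  "'j set \<Rightarrow> ('j \<Rightarrow> 'k set) \<Rightarrow> ('j \<Rightarrow> 'k set) \<Rightarrow> ('j \<Rightarrow> 'k set) \<Rightarrow>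
   ('j \<Rightarrow> 'k \<Rightarrow> real) \<Rightarrow> ('j \<Rightarrow> 'k \<Rightarrow> real) \<Rightarrow> (('j \<Rightarrow> real) \<times> ('j \<Rightarrow> 'k \<Rightarrow> real)) set" where
  "SP1_feasible J K KL KU xl xu =
     {(d, x).
        (\<forall>j\<in>J. d j = exp (- (\<Sum>k\<in>K j. x j k)) / (1 + (\<Sum>i\<in>J. exp (- (\<Sum>k\<in>K i. x i k))))) \<and>
        (\<forall>j\<in>J. \<forall>k\<in>KL j. x j k \<ge> xl j k) \<and>
        (\<forall>j\<in>J. \<forall>k\<in>KU j. x j k \<le> xu j k)}"

definition SP1_objective ::
  "'j set \<Rightarrow> ('j \<Rightarrow> 'k set) \<Rightarrow> ('k \<Rightarrow> real) \<Rightarrow> ('j \<Rightarrow> real) \<Rightarrow>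
   ('j \<Rightarrow> real) \<times> ('j \<Rightarrow> 'k \<Rightarrow> real) \<Rightarrow> real" where
  "SP1_objective J K \<phi> \<psi> = (\<lambda>(d, x). \<Sum>j\<in>J. ((\<Sum>k\<in>K j. \<phi> k * x j k) - \<psi> j) * d j)"

definition SP5_feasible ::
  "'j set \<Rightarrow> ('j \<Rightarrow> 'k set) \<Rightarrow> ('j \<Rightarrow> 'k set) \<Rightarrow> ('j \<Rightarrow> 'k set) \<Rightarrow>
   ('j \<Rightarrow> 'k \<Rightarrow> real) \<Rightarrow> ('j \<Rightarrow> 'k \<Rightarrow> real) \<Rightarrow>
   (('j \<Rightarrow> real) \<times> real \<times> ('j \<Rightarrow> 'k \<Rightarrow> real)) set" where
  "SP5_feasible J K KL KU xl xu =
     {(d, d0, u).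
        (\<forall>j\<in>J. (d0, d j, \<Sum>k\<in>K j. u j k) \<in> exp_cone) \<and>
        (\<forall>j\<in>fully_upper_bounded J K KU. (d j, d0, - (\<Sum>k\<in>K j. xu j k * d0)) \<in> exp_cone) \<and>
        (\<forall>j\<in>J. \<forall>k\<in>KL j. u j k \<ge> xl j k * d j) \<and>
        (\<forall>j\<in>J. \<forall>k\<in>KU j. u j k \<le> xu j k * d j) \<and>
        d0 + (\<Sum>j\<in>J. d j) = 1}"

definition SP5_objective ::
  "'j set \<Rightarrow> ('j \<Rightarrow> 'k set) \<Rightarrow> ('k \<Rightarrow> real) \<Rightarrow> ('j \<Rightarrow> real) \<Rightarrow>
   ('j \<Rightarrow> real) \<times> real \<times> ('j \<Rightarrow> 'k \<Rightarrow> real) \<Rightarrow> real" where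
  "SP5_objective J K \<phi> \<psi> = (\<lambda>(d, d0, u). \<Sum>j\<in>J. ((\<Sum>k\<in>K j. \<phi> k * u j k) - \<psi> j * d j))"

text \<open>
  The data of the second program enter through linear constraints and membership in
  \<^const>\<open>exp_cone\<close>, so the next two facts are what makes it a convex conic program.
\<close>

lemma cone_exp_cone: "cone exp_cone"
  unfolding cone_def
proof (intro ballI allI impI)
  fix p :: "real \<times> real \<times> real" and t :: real
  assume p: "p \<in> exp_cone" and t: "0 \<le> t"
  obtain a b c where e: "p = (a, b, c)"
    by (metis prod.exhaust)
  have "(t * a, t * b, t * c) \<in> exp_cone"
    using p t unfolding e exp_cone_def
    by (cases "t = 0") (auto simp: mult_left_mono mult.assoc mult_nonneg_nonpos)
  then show "t *\<^sub>R p \<in> exp_cone"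
    by (simp add: e)
qed

lemma perspective_ln_bound:
  fixes a b t :: real
  assumes "a > 0" "b > 0" "t > 0"
  shows "b * ln (a / b) \<le> b * ln t + a / t - b"
proof -
  have "ln (a / b / t) \<le> a / b / t - 1"
    using assms by (intro ln_le_minus_one) simp
  then have "ln (a / b) \<le> ln t + a / b / t - 1"
    using assms by (simp add: ln_div ln_mult)
  then have "b * ln (a / b) \<le> b * (ln t + a / b / t - 1)"
    using assms by (intro mult_left_mono) auto
  then show ?thesis
    using assms by (simp add: algebra_simps)
qed

lemma convex_exp_cone: "convex exp_cone"
proof -
  have add: "p + q \<in> exp_cone" if p: "p \<in> exp_cone" and q: "q \<in> exp_cone" for p q
  proof -
    obtain a1 a2 a3 b1 b2 b3 where e: "p = (a1, a2, a3)" "q = (b1, b2, b3)"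
      by (metis prod.exhaust)
    consider "a2 = 0" "b2 = 0" | "a2 = 0" "b2 > 0" | "a2 > 0" "b2 = 0" | "a2 > 0" "b2 > 0"
      using p q unfolding e exp_cone_def by auto
    then show ?thesis
    proof cases
      case 1
      then show ?thesis using p q unfolding e exp_cone_def by auto
    next
      case 2
      have "b2 * ln (b1 / b2) \<le> b2 * ln ((a1 + b1) / b2)"
        using 2 p q unfolding e exp_cone_def
        by (intro mult_left_mono ln_mono divide_right_mono) (auto simp: add_nonneg_pos)
      moreover have "a1 \<ge> 0" "a3 \<le> 0" "b1 > 0" "b3 \<le> b2 * ln (b1 / b2)"
        using 2 p q unfolding e exp_cone_def by auto
      ultimately have "a3 + b3 \<le> b2 * ln ((a1 + b1) / b2)" "a1 + b1 > 0"
        by linarith+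
      then show ?thesis using 2 unfolding e exp_cone_def by simp
    next
      case 3
      have "a2 * ln (a1 / a2) \<le> a2 * ln ((a1 + b1) / a2)"
        using 3 p q unfolding e exp_cone_def
        by (intro mult_left_mono ln_mono divide_right_mono) (auto simp: add_pos_nonneg)
      moreover have "b1 \<ge> 0" "b3 \<le> 0" "a1 > 0" "a3 \<le> a2 * ln (a1 / a2)"
        using 3 p q unfolding e exp_cone_def by auto
      ultimately have "a3 + b3 \<le> a2 * ln ((a1 + b1) / a2)" "a1 + b1 > 0"
        by linarith+
      then show ?thesis using 3 unfolding e exp_cone_def by simp
    next
      case 4
      have h: "a1 > 0" "b1 > 0" "a3 \<le> a2 * ln (a1 / a2)" "b3 \<le> b2 * ln (b1 / b2)"
        using 4 p q unfolding e exp_cone_def by auto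
      define t where "t = (a1 + b1) / (a2 + b2)"
      have t: "t > 0" using h 4 by (simp add: t_def)
      have "a1 / t + b1 / t = (a1 + b1) / t"
        by (simp add: add_divide_distrib)
      also have "\<dots> = a2 + b2"
        using add_pos_pos[OF h(1,2)] by (simp add: t_def)
      finally have "a1 / t + b1 / t = a2 + b2" .
      then have "a3 + b3 \<le> (a2 + b2) * ln t"
        using perspective_ln_bound[OF h(1) 4(1) t] perspective_ln_bound[OF h(2) 4(2) t] h(3,4)
        by (simp add: algebra_simps)
      then show ?thesis using h 4 unfolding e exp_cone_def t_def by auto
    qed
  qed
  show ?thesis
    unfolding convex_def using cone_exp_cone add by (simp add: cone_def)
qed

end

theory Submission
  imports Defs "HOL-Real_Asymp.Real_Asymp"
begin

text \<open>
  The demands are determined by the prices, and the objective of the first program is a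
  quotient \<open>N x / D x\<close>, where both \<open>N\<close> and \<open>D - 1\<close> are sums over the products of a function of
  the prices of that product. A quotient with \<open>D \<ge> 1\<close> has a maximum as soon as \<open>N - r D\<close> has
  one for every \<open>r\<close> (\<open>fractional_maximum_parameter\<close>), and the latter problem decouples: for each
  product, one maximizes \<open>((\<Sum>k\<in>K. \<phi> k * x k) - c) * exp (- sum x K)\<close> over the price bounds.

  Under the ordering condition on the coefficients this maximum exists
  (\<open>revenue_attains_max\<close>). The total \<open>sum x K\<close> can be confined to a bounded interval, and for
  a given total the prices can be moved near a fixed admissible point without losing revenue
  (\<open>exchange_towards_anchor\<close>), which leaves a compact set of candidates. If the
  condition fails, two prices can be traded against each other for ever at constant demand and
  with linear gain (\<open>SP1_unbounded\<close>).

  For the conic program, let \<open>r\<close> be the optimal value of the first one. For each product, a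
  conic point yields admissible prices whose revenue, with \<open>r\<close> as additional unit cost and
  weighted by \<open>d0\<close>, is at least the contribution of that product; equality forces positive
  demand and a tight cone constraint (\<open>conic_contribution_dominated\<close>). By the choice of \<open>r\<close>
  these revenues sum to at most \<open>r\<close>, so the conic program has the same value \<open>r\<close>, and each of
  its optimal points comes from optimal prices.
\<close>

section \<open>Fractional maximization\<close>

text \<open>
  The maximum \<open>G r\<close> of \<open>N - r D\<close> is an attained supremum of affine functions of \<open>r\<close>, hence
  convex and continuous; it is nonnegative for very negative \<open>r\<close> and nonpositive for large
  \<open>r\<close> because \<open>D \<ge> 1\<close>. At a root, the maximizer attains the largest quotient, which is the
  root itself.
\<close>

lemma fractional_maximum_parameter:
  fixes N D :: "'a \<Rightarrow> real"
  assumes ne: "X \<noteq> {}" and D: "\<And>x. x \<in> X \<Longrightarrow> 1 \<le> D x"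
    and max: "\<And>r. \<exists>x\<in>X. \<forall>y\<in>X. N y - r * D y \<le> N x - r * D x"
  obtains r x where "x \<in> X" "N x = r * D x" "\<And>y. y \<in> X \<Longrightarrow> N y \<le> r * D y"
proof -
  obtain m where m: "\<And>r. m r \<in> X" "\<And>r y. y \<in> X \<Longrightarrow> N y - r * D y \<le> N (m r) - r * D (m r)"
    using max by metis
  define G where "G r = N (m r) - r * D (m r)" for r
  have G: "N y - r * D y \<le> G r" if "y \<in> X" for r y
    using m(2) that by (simp add: G_def)
  have "convex_on UNIV G"
  proof (rule convex_onI)
    fix t a b :: real
    assume t: "0 < t" "t < 1"
    define x where "x = m ((1 - t) *\<^sub>R a + t *\<^sub>R b)"
    have "G ((1 - t) *\<^sub>R a + t *\<^sub>R b) = (1 - t) * (N x - a * D x) + t * (N x - b * D x)"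
      unfolding G_def x_def[symmetric] by (simp add: algebra_simps)
    also have "\<dots> \<le> (1 - t) * G a + t * G b"
      using G m(1) t by (intro add_mono mult_left_mono) (auto simp: x_def)
    finally show "G ((1 - t) *\<^sub>R a + t *\<^sub>R b) \<le> (1 - t) * G a + t * G b" .
  qed simp
  then have cont: "continuous_on UNIV G"
    using convex_on_continuous open_UNIV by blast
  obtain x0 where x0: "x0 \<in> X" using ne by blast
  \<comment> \<open>Chosen so that \<open>G a \<ge> N x0 - a \<ge> 0\<close> and \<open>G b \<le> G 0 - b \<le> 0\<close>, both by \<open>D \<ge> 1\<close>.\<close>
  define a where "a = min 0 (N x0)"
  define b where "b = max 0 (G 0)"
  have "0 \<le> - a * (D x0 - 1)"
    using D[OF x0] by (intro mult_nonneg_nonneg) (auto simp: a_def)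
  then have "0 \<le> N x0 - a * D x0" by (simp add: algebra_simps a_def)
  then have lo: "0 \<le> G a" using G[OF x0, of a] by linarith
  have "0 \<le> b * (D (m b) - 1)"
    using D[OF m(1)] by (intro mult_nonneg_nonneg) (auto simp: b_def)
  moreover have "N (m b) \<le> G 0" using G[OF m(1), of b 0] by simp
  ultimately have hi: "G b \<le> 0" by (simp add: G_def algebra_simps b_def)
  have "a \<le> b" by (simp add: a_def b_def)
  then obtain r where r: "G r = 0"
    using IVT2'[of G b 0 a] lo hi continuous_on_subset[OF cont, of "{a..b}"] by auto
  show ?thesis
  proof
    show "m r \<in> X" by (rule m(1))
    show "N (m r) = r * D (m r)" using r by (simp add: G_def)
    show "N y \<le> r * D y" if "y \<in> X" for y using G[OF that, of r] r by simp
  qed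
qed

section \<open>Prices of one product\<close>

definition admissible :: "'k set \<Rightarrow> 'k set \<Rightarrow> ('k \<Rightarrow> real) \<Rightarrow> ('k \<Rightarrow> real) \<Rightarrow> ('k \<Rightarrow> real) set" where
  "admissible L U l u = {x. (\<forall>k\<in>L. l k \<le> x k) \<and> (\<forall>k\<in>U. x k \<le> u k)}"

text \<open>
  The weight \<open>exp (- sum x K)\<close> is the demand of a product relative to the demand of the outside
  option, and \<open>c\<close> is a cost per unit sold.
\<close>

definition revenue :: "'k set \<Rightarrow> ('k \<Rightarrow> real) \<Rightarrow> real \<Rightarrow> ('k \<Rightarrow> real) \<Rightarrow> real" where
  "revenue K \<phi> c x = ((\<Sum>k\<in>K. \<phi> k * x k) - c) * exp (- (\<Sum>k\<in>K. x k))"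

lemma intermediate_sum:
  fixes a b :: "'k \<Rightarrow> real"
  assumes ab: "\<And>k. k \<in> K \<Longrightarrow> a k \<le> b k" and s: "sum a K \<le> s" "s \<le> sum b K"
  obtains y where "\<And>k. k \<in> K \<Longrightarrow> a k \<le> y k" "\<And>k. k \<in> K \<Longrightarrow> y k \<le> b k"
    "sum y K = s" "\<And>k. k \<notin> K \<Longrightarrow> y k = a k"
proof -
  define f where "f t = (\<Sum>k\<in>K. a k + t * (b k - a k))" for t :: real
  have "continuous_on {0..1} f" unfolding f_def by (intro continuous_intros)
  then obtain t where t: "0 \<le> t" "t \<le> 1" "f t = s"
    using IVT'[of f 0 s 1] s by (auto simp: f_def)
  show ?thesis
  proof (rule that[of "\<lambda>k. if k \<in> K then a k + t * (b k - a k) else a k"])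
    fix k assume k: "k \<in> K"
    show "a k \<le> (if k \<in> K then a k + t * (b k - a k) else a k)"
      using ab[OF k] t by simp
    have "t * (b k - a k) \<le> 1 * (b k - a k)"
      using ab[OF k] t by (intro mult_right_mono) auto
    then show "(if k \<in> K then a k + t * (b k - a k) else a k) \<le> b k"
      using k by simp
  qed (use t in \<open>auto simp: f_def\<close>)
qed

locale attribute_bounds =
  fixes K L U :: "'k set" and l u \<phi> :: "'k \<Rightarrow> real"
  assumes fin: "finite K" and ne: "K \<noteq> {}" and LK: "L \<subseteq> K" and UK: "U \<subseteq> K"
    and lu: "\<And>k. k \<in> L \<inter> U \<Longrightarrow> l k \<le> u k" and pos: "\<And>k. k \<in> K \<Longrightarrow> 0 < \<phi> k"
begin

lemma admissible_nonempty: "admissible L U l u \<noteq> {}"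
proof -
  have "(\<lambda>k. if k \<in> L then l k else u k) \<in> admissible L U l u"
    using lu by (auto simp: admissible_def)
  then show ?thesis by blast
qed

lemma positive_revenue:
  assumes "U \<noteq> K"
  obtains x where "x \<in> admissible L U l u" "0 < revenue K \<phi> c x"
proof -
  obtain k where k: "k \<in> K" "k \<notin> U" using assms UK by blast
  obtain z where z: "z \<in> admissible L U l u" using admissible_nonempty by blast
  define b where "b = (\<bar>c - (\<Sum>i\<in>K. \<phi> i * z i)\<bar> + 1) / \<phi> k"
  have b: "0 < b" "\<phi> k * b = \<bar>c - (\<Sum>i\<in>K. \<phi> i * z i)\<bar> + 1"
    using pos[OF k(1)] by (auto simp: b_def)
  have "(\<Sum>i\<in>K. \<phi> i * (z(k := z k + b)) i)
      = (\<Sum>i\<in>K. \<phi> i * z i + (if i = k then \<phi> k * b else 0))"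
    by (intro sum.cong) (auto simp: algebra_simps)
  also have "\<dots> = (\<Sum>i\<in>K. \<phi> i * z i) + \<phi> k * b"
    using k fin by (simp add: sum.distrib)
  also have "\<dots> > c" using b(2) by linarith
  finally have "0 < revenue K \<phi> c (z(k := z k + b))" by (simp add: revenue_def)
  moreover have "z(k := z k + b) \<in> admissible L U l u"
    using z k b(1) by (auto simp: admissible_def)
  ultimately show ?thesis using that by blast
qed

text \<open>
  The second constraint of the conic program prescribes \<open>s \<le> sum u K\<close> when every
  attribute has an upper bound; otherwise an attribute without one absorbs the increase.
\<close>

lemma raise_to_sum:
  assumes x: "x \<in> admissible L U l u" and s: "sum x K \<le> s" "U = K \<Longrightarrow> s \<le> sum u K"
  obtains y where "y \<in> admissible L U l u" "\<And>k. k \<in> K \<Longrightarrow> x k \<le> y k" "sum y K = s"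
proof -
  obtain b where b: "\<And>k. k \<in> K \<Longrightarrow> x k \<le> b k" "s \<le> sum b K" "\<And>k. k \<in> U \<Longrightarrow> b k \<le> u k"
  proof (cases "U = K")
    case True
    then show ?thesis using that[of u] x s by (auto simp: admissible_def)
  next
    case False
    then obtain k where k: "k \<in> K" "k \<notin> U" using UK by blast
    have "sum (x(k := x k + (s - sum x K))) K
        = (\<Sum>i\<in>K. x i + (if i = k then s - sum x K else 0))"
      by (intro sum.cong) auto
    also have "\<dots> = s" using k fin by (simp add: sum.distrib)
    finally have "sum (x(k := x k + (s - sum x K))) K = s" .
    then show ?thesis
      using x s k by (intro that[of "x(k := x k + (s - sum x K))"]) (auto simp: admissible_def)
  qed
  obtain y where y: "\<And>k. k \<in> K \<Longrightarrow> x k \<le> y k" "\<And>k. k \<in> K \<Longrightarrow> y k \<le> b k" "sum y K = s"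
    using intermediate_sum[of K x b s] b s by metis
  have "y \<in> admissible L U l u"
    using x y(1,2) b(3) LK UK unfolding admissible_def
    by (smt (verit) mem_Collect_eq subsetD)
  then show ?thesis using that y by blast
qed

text \<open>
  At prices \<open>x\<close>, the choice probabilities satisfy \<open>d = d0 * exp (- sum x K)\<close>, which makes the
  first cone constraint tight and turns the second one into \<open>sum x K \<le> sum u K\<close>.
\<close>

lemma prices_in_exp_cone:
  assumes x: "x \<in> admissible L U l u" and d0: "0 < d0" and d: "d = d0 * exp (- sum x K)"
  shows "(d0, d, \<Sum>k\<in>K. x k * d) \<in> exp_cone"
    and "U = K \<Longrightarrow> (d, d0, - (\<Sum>k\<in>K. u k * d0)) \<in> exp_cone"
proof -
  have pos: "0 < d" using d0 d by simp
  have "d / d0 = exp (- sum x K)" "d0 / d = exp (sum x K)"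
    using d0 by (auto simp: d exp_minus field_simps)
  then have ln: "ln (d / d0) = - sum x K" "ln (d0 / d) = sum x K" by simp_all
  show "(d0, d, \<Sum>k\<in>K. x k * d) \<in> exp_cone"
    using pos d0 by (simp add: exp_cone_def ln sum_distrib_left mult.commute)
  assume "U = K"
  then have "sum x K \<le> sum u K" using x by (auto simp: admissible_def intro: sum_mono)
  then show "(d, d0, - (\<Sum>k\<in>K. u k * d0)) \<in> exp_cone"
    using pos d0 by (simp add: exp_cone_def ln flip: sum_distrib_right)
qed

text \<open>
  The largest coefficient without an upper bound separates; if there is none, the smallest
  coefficient at all does.
\<close>

lemma ordered_bounds_separated:
  assumes "\<forall>k1\<in>K - U. \<forall>k2\<in>K - L. \<phi> k1 \<le> \<phi> k2"
  shows "\<exists>\<mu>. 0 < \<mu> \<and> (\<forall>k\<in>K - U. \<phi> k \<le> \<mu>) \<and> (\<forall>k\<in>K - L. \<mu> \<le> \<phi> k)"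
proof (cases "K - U = {}")
  case True
  have "Min (\<phi> ` K) \<in> \<phi> ` K" using fin ne by simp
  then have "0 < Min (\<phi> ` K)" using pos by auto
  then show ?thesis using True fin by (intro exI[of _ "Min (\<phi> ` K)"]) auto
next
  case False
  then have m: "Max (\<phi> ` (K - U)) \<in> \<phi> ` (K - U)" using fin by (intro Max_in) auto
  then have "0 < Max (\<phi> ` (K - U))" using pos by auto
  moreover have "Max (\<phi> ` (K - U)) \<le> \<phi> k" if "k \<in> K - L" for k
    using m that assms by auto
  ultimately show ?thesis using fin by (intro exI[of _ "Max (\<phi> ` (K - U))"]) auto
qed

end

section \<open>Attainment for one product\<close>

text \<open>
  Trading one unit of the total price between two attributes can be repeated for ever only from
  one without a lower bound to one without an upper bound. If a value \<open>\<mu>\<close> separates the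
  coefficients of these two kinds, no such trade pays: every coefficient below \<open>\<mu>\<close> belongs to
  an attribute with a lower bound, and every coefficient above \<open>\<mu>\<close> to one with an upper bound.
\<close>

locale separated_bounds = attribute_bounds +
  fixes \<mu> :: real
  assumes mu_pos: "0 < \<mu>" and mu_upper: "\<And>k. k \<in> K - U \<Longrightarrow> \<phi> k \<le> \<mu>"
    and mu_lower: "\<And>k. k \<in> K - L \<Longrightarrow> \<mu> \<le> \<phi> k"
begin

text \<open>
  The separation makes each \<open>(\<phi> k - \<mu>) * v k\<close> nonpositive, so the value is at most
  \<open>\<mu> * sum v K\<close>. The hypotheses are the constraints that the conic program puts on a product
  with zero demand.
\<close>

lemma recession_value_nonpos:
  assumes "\<And>k. k \<in> L \<Longrightarrow> 0 \<le> v k" "\<And>k. k \<in> U \<Longrightarrow> v k \<le> 0" "sum v K \<le> 0"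
  shows "(\<Sum>k\<in>K. \<phi> k * v k) \<le> 0"
proof -
  have "(\<phi> k - \<mu>) * v k \<le> 0" if k: "k \<in> K" for k
  proof (cases "\<phi> k" \<mu> rule: linorder_cases)
    case less
    then show ?thesis using assms(1) mu_lower[of k] k by (force simp: mult_le_0_iff)
  next
    case greater
    then show ?thesis using assms(2) mu_upper[of k] k by (force simp: mult_le_0_iff)
  qed simp
  then have "(\<Sum>k\<in>K. (\<phi> k - \<mu>) * v k) \<le> 0" by (intro sum_nonpos) auto
  moreover have "(\<Sum>k\<in>K. (\<phi> k - \<mu>) * v k) = (\<Sum>k\<in>K. \<phi> k * v k) - \<mu> * sum v K"
    by (simp add: left_diff_distrib sum_subtractf sum_distrib_left)
  moreover have "\<mu> * sum v K \<le> 0" using mu_pos assms(3) by (simp add: mult_le_0_iff)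
  ultimately show ?thesis by linarith
qed

text \<open>
  An attribute with \<open>\<phi> k < \<mu>\<close> sits at its lower bound and one with \<open>\<phi> k > \<mu>\<close> at its upper
  bound, so this point maximizes \<open>\<Sum>k\<in>K. (\<phi> k - \<mu>) * x k\<close> over the admissible points. If
  \<open>\<phi> k = \<mu>\<close>, any admissible value would do.
\<close>

definition anchor :: "'a \<Rightarrow> real" where
  "anchor k = (if \<phi> k < \<mu> \<or> k \<notin> U \<and> k \<in> L then l k else if k \<in> U then u k else 0)"

lemma anchor_admissible: "anchor \<in> admissible L U l u"
proof -
  have "l k \<le> anchor k" if "k \<in> L" for k
    using that lu[of k] mu_upper[of k] LK by (auto simp: anchor_def)
  moreover have "anchor k \<le> u k" if "k \<in> U" for k
    using that lu[of k] mu_lower[of k] UK by (force simp: anchor_def)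
  ultimately show ?thesis by (simp add: admissible_def)
qed

lemma anchor_low:
  assumes "x \<in> admissible L U l u" "k \<in> K" "\<phi> k < \<mu>"
  shows "anchor k \<le> x k"
  using assms mu_lower[of k] by (force simp: anchor_def admissible_def)

lemma anchor_high:
  assumes "x \<in> admissible L U l u" "k \<in> K" "\<mu> < \<phi> k"
  shows "x k \<le> anchor k"
  using assms mu_upper[of k] by (force simp: anchor_def admissible_def)

text \<open>
  The superlevel sets of the revenue need not be bounded, because unbounded attributes with
  equal coefficients can be traded freely. This lemma restores compactness: a point with the
  same total that lies all above or all below the anchor has each displacement bounded by the
  difference of the totals. Interpolating between the anchor and the pointwise maximum (or
  minimum) of both points gives it. Relative to \<open>x\<close>, attributes with \<open>\<phi> k < \<mu>\<close> have only
  moved down and those with \<open>\<phi> k > \<mu>\<close> only up, which cannot lose revenue at a fixed total.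
\<close>

lemma exchange_towards_anchor:
  assumes x: "x \<in> admissible L U l u"
  obtains y where "y \<in> admissible L U l u" "sum y K = sum x K"
    "revenue K \<phi> c x \<le> revenue K \<phi> c y"
    "\<And>k. \<bar>y k - anchor k\<bar> \<le> \<bar>sum x K - sum anchor K\<bar>"
proof -
  have adm: "l k \<le> anchor k" "l k \<le> x k" if "k \<in> L" for k
    using that anchor_admissible x by (auto simp: admissible_def)
  have adm': "anchor k \<le> u k" "x k \<le> u k" if "k \<in> U" for k
    using that anchor_admissible x by (auto simp: admissible_def)
  obtain y where y: "sum y K = sum x K" "\<And>k. k \<notin> K \<Longrightarrow> y k = anchor k"
    and between: "\<And>k. k \<in> K \<Longrightarrow> min (x k) (anchor k) \<le> y k" "\<And>k. k \<in> K \<Longrightarrow> y k \<le> max (x k) (anchor k)"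
    and low: "\<And>k. k \<in> K \<Longrightarrow> \<phi> k < \<mu> \<Longrightarrow> y k \<le> x k"
    and high: "\<And>k. k \<in> K \<Longrightarrow> \<mu> < \<phi> k \<Longrightarrow> x k \<le> y k"
    and dir: "(\<forall>k\<in>K. anchor k \<le> y k) \<or> (\<forall>k\<in>K. y k \<le> anchor k)"
  proof (cases "sum anchor K \<le> sum x K")
    case True
    obtain y where y: "\<And>k. k \<in> K \<Longrightarrow> anchor k \<le> y k" "\<And>k. k \<in> K \<Longrightarrow> y k \<le> max (x k) (anchor k)"
      "sum y K = sum x K" "\<And>k. k \<notin> K \<Longrightarrow> y k = anchor k"
      using intermediate_sum[of K anchor "\<lambda>k. max (x k) (anchor k)" "sum x K"] True
      by (auto simp: sum_mono)
    show ?thesis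
    proof (rule that[of y])
      show "y k \<le> x k" if "k \<in> K" "\<phi> k < \<mu>" for k
        using y(2)[of k] anchor_low[OF x] that by fastforce
      show "x k \<le> y k" if "k \<in> K" "\<mu> < \<phi> k" for k
        using y(1)[of k] anchor_high[OF x] that by fastforce
    qed (use y in \<open>auto simp: min_le_iff_disj\<close>)
  next
    case False
    obtain y where y: "\<And>k. k \<in> K \<Longrightarrow> min (x k) (anchor k) \<le> y k" "\<And>k. k \<in> K \<Longrightarrow> y k \<le> anchor k"
      "sum y K = sum x K" "\<And>k. k \<notin> K \<Longrightarrow> y k = min (x k) (anchor k)"
      using intermediate_sum[of K "\<lambda>k. min (x k) (anchor k)" anchor "sum x K"] False
      by (auto simp: sum_mono)
    define w where "w k = (if k \<in> K then y k else anchor k)" for k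
    have w: "w k = y k" if "k \<in> K" for k using that by (simp add: w_def)
    have "sum w K = sum x K" using y(3) w by (metis sum.cong)
    moreover have "w k = anchor k" if "k \<notin> K" for k using that by (simp add: w_def)
    moreover have "w k \<le> x k" if "k \<in> K" "\<phi> k < \<mu>" for k
      using y(2)[of k] anchor_low[OF x] that w by fastforce
    moreover have "x k \<le> w k" if "k \<in> K" "\<mu> < \<phi> k" for k
      using y(1)[of k] anchor_high[OF x] that w by fastforce
    ultimately show ?thesis
      using y w by (intro that[of w]) (auto simp: le_max_iff_disj)
  qed
  have "y \<in> admissible L U l u"
    using adm adm' between LK UK unfolding admissible_def
    by (smt (verit) mem_Collect_eq subsetD)
  moreover have "revenue K \<phi> c x \<le> revenue K \<phi> c y"
  proof -
    have "0 \<le> (\<phi> k - \<mu>) * (y k - x k)" if k: "k \<in> K" for k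
      using low[OF k] high[OF k] by (cases "\<phi> k" \<mu> rule: linorder_cases) (auto simp: zero_le_mult_iff)
    then have "0 \<le> (\<Sum>k\<in>K. (\<phi> k - \<mu>) * (y k - x k))" by (intro sum_nonneg) auto
    also have "\<dots> = (\<Sum>k\<in>K. \<phi> k * y k) - (\<Sum>k\<in>K. \<phi> k * x k) - \<mu> * (sum y K - sum x K)"
      by (simp add: algebra_simps sum.distrib sum_subtractf sum_distrib_left)
    finally show ?thesis using y(1) by (simp add: revenue_def)
  qed
  moreover have "\<bar>y k - anchor k\<bar> \<le> \<bar>sum x K - sum anchor K\<bar>" for k
  proof (cases "k \<in> K")
    case True
    have "\<bar>y k - anchor k\<bar> \<le> (\<Sum>k\<in>K. \<bar>y k - anchor k\<bar>)"
      using fin True by (intro member_le_sum) auto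
    also have "\<dots> = \<bar>\<Sum>k\<in>K. y k - anchor k\<bar>"
      using dir
    proof
      assume *: "\<forall>k\<in>K. anchor k \<le> y k"
      then have "(\<Sum>k\<in>K. \<bar>y k - anchor k\<bar>) = (\<Sum>k\<in>K. y k - anchor k)"
        by (intro sum.cong) auto
      moreover have "0 \<le> (\<Sum>k\<in>K. y k - anchor k)" using * by (intro sum_nonneg) auto
      ultimately show ?thesis by simp
    next
      assume *: "\<forall>k\<in>K. y k \<le> anchor k"
      then have "(\<Sum>k\<in>K. \<bar>y k - anchor k\<bar>) = (\<Sum>k\<in>K. - (y k - anchor k))"
        by (intro sum.cong) auto
      moreover have "(\<Sum>k\<in>K. y k - anchor k) \<le> 0" using * by (intro sum_nonpos) auto
      ultimately show ?thesis by (simp add: sum_negf sum_subtractf)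
    qed
    finally show ?thesis using y(1) by (simp add: sum_subtractf)
  qed (use y(2) in simp)
  ultimately show ?thesis using that y(1) by blast
qed

lemma revenue_upper_bound:
  assumes x: "x \<in> admissible L U l u"
  shows "revenue K \<phi> c x
    \<le> (\<mu> * sum x K + ((\<Sum>k\<in>K. (\<phi> k - \<mu>) * anchor k) - c)) * exp (- sum x K)"
proof -
  have "(\<phi> k - \<mu>) * x k \<le> (\<phi> k - \<mu>) * anchor k" if k: "k \<in> K" for k
    using anchor_low[OF x k] anchor_high[OF x k]
    by (cases "\<phi> k" \<mu> rule: linorder_cases) (auto intro: mult_left_mono mult_left_mono_neg)
  then have "(\<Sum>k\<in>K. (\<phi> k - \<mu>) * x k) \<le> (\<Sum>k\<in>K. (\<phi> k - \<mu>) * anchor k)" by (rule sum_mono)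
  moreover have "(\<Sum>k\<in>K. (\<phi> k - \<mu>) * x k) = (\<Sum>k\<in>K. \<phi> k * x k) - \<mu> * sum x K"
    by (simp add: left_diff_distrib sum_subtractf sum_distrib_left)
  ultimately show ?thesis unfolding revenue_def by (intro mult_right_mono) auto
qed

text \<open>
  The preceding upper bound tends to \<open>- \<infinity>\<close> for totals going to \<open>- \<infinity>\<close>. For large totals it
  only tends to \<open>0\<close>, which suffices: either the totals are bounded above, or the point \<open>z\<close>
  to be beaten can be taken with positive revenue.
\<close>

lemma good_totals_bounded:
  obtains z R where "z \<in> admissible L U l u"
    "\<And>x. x \<in> admissible L U l u \<Longrightarrow> revenue K \<phi> c z \<le> revenue K \<phi> c x \<Longrightarrow> \<bar>sum x K - sum anchor K\<bar> \<le> R"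
proof -
  define A where "A = (\<Sum>k\<in>K. (\<phi> k - \<mu>) * anchor k) - c"
  define g where "g s = (\<mu> * s + A) * exp (- s)" for s
  have g: "revenue K \<phi> c x \<le> g (sum x K)" if "x \<in> admissible L U l u" for x
    using revenue_upper_bound[OF that] by (simp add: g_def A_def)
  have "filterlim g at_bot at_bot" unfolding g_def using mu_pos by real_asymp
  then have ev: "\<exists>a. \<forall>s\<le>a. g s < b" for b
    by (simp add: filterlim_at_bot_dense eventually_at_bot_linorder)
  have lim: "(g \<longlongrightarrow> 0) at_top" unfolding g_def using mu_pos by real_asymp
  obtain z T where z: "z \<in> admissible L U l u"
    and T: "\<And>x. x \<in> admissible L U l u \<Longrightarrow> revenue K \<phi> c z \<le> revenue K \<phi> c x \<Longrightarrow> sum x K \<le> T"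
  proof (cases "U = K")
    case True
    then have "sum x K \<le> sum u K" if "x \<in> admissible L U l u" for x
      using that by (auto simp: admissible_def intro: sum_mono)
    then show ?thesis using that[of anchor "sum u K"] anchor_admissible by blast
  next
    case False
    obtain z where z: "z \<in> admissible L U l u" "0 < revenue K \<phi> c z"
      using positive_revenue[OF False] by blast
    have "eventually (\<lambda>s. g s < revenue K \<phi> c z) at_top"
      using order_tendstoD(2)[OF lim z(2)] .
    then obtain T where "\<forall>s\<ge>T. g s < revenue K \<phi> c z" by (auto simp: eventually_at_top_linorder)
    then show ?thesis using that[of z T] z(1) g by (meson linear not_less order.strict_trans2 order_trans)
  qed
  obtain a where a: "\<forall>s\<le>a. g s < revenue K \<phi> c z" using ev by blast
  show ?thesis
  proof (rule that[of z "\<bar>a - sum anchor K\<bar> + \<bar>T - sum anchor K\<bar>"])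
    fix x assume x: "x \<in> admissible L U l u" "revenue K \<phi> c z \<le> revenue K \<phi> c x"
    have "a \<le> sum x K" using a g[OF x(1)] x(2) by (meson linear not_less order_trans)
    then show "\<bar>sum x K - sum anchor K\<bar> \<le> \<bar>a - sum anchor K\<bar> + \<bar>T - sum anchor K\<bar>"
      using T[OF x] by linarith
  qed (rule z)
qed

lemma revenue_attains_max:
  obtains x where "x \<in> admissible L U l u"
    "\<And>y. y \<in> admissible L U l u \<Longrightarrow> revenue K \<phi> c y \<le> revenue K \<phi> c x"
proof -
  obtain z R where z: "z \<in> admissible L U l u"
    and R: "\<And>x. x \<in> admissible L U l u \<Longrightarrow> revenue K \<phi> c z \<le> revenue K \<phi> c x \<Longrightarrow>
      \<bar>sum x K - sum anchor K\<bar> \<le> R"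
    using good_totals_bounded by blast
  \<comment> \<open>The coordinates outside \<open>K\<close> are confined too, to make the product compact.\<close>
  define I where "I k = {anchor k - R..anchor k + R} \<inter>
    ((if k \<in> L then {l k..} else UNIV) \<inter> (if k \<in> U then {..u k} else UNIV))" for k
  define Q where "Q = PiE UNIV I"
  have Q: "y \<in> Q \<longleftrightarrow> y \<in> admissible L U l u \<and> (\<forall>k. \<bar>y k - anchor k\<bar> \<le> R)" for y
    by (auto simp: Q_def I_def PiE_iff admissible_def abs_le_iff algebra_simps split: if_splits)
  have "compact (I k)" for k
    unfolding I_def by (intro compact_Int_closed closed_Int) auto
  then have "compactin (product_topology (\<lambda>_. euclidean) UNIV) Q"
    unfolding Q_def compactin_PiE by simp
  then have "compact Q" by (simp add: euclidean_product_topology)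
  moreover have improve: "\<exists>y\<in>Q. revenue K \<phi> c x \<le> revenue K \<phi> c y"
    if x: "x \<in> admissible L U l u" "revenue K \<phi> c z \<le> revenue K \<phi> c x" for x
    using exchange_towards_anchor[OF x(1), of c] R[OF x] Q by (metis order_trans)
  moreover have "continuous_on Q (revenue K \<phi> c)"
    unfolding revenue_def
    by (intro continuous_intros continuous_on_subset[OF continuous_on_product_coordinates subset_UNIV])
  ultimately obtain q where q: "q \<in> Q" "\<And>y. y \<in> Q \<Longrightarrow> revenue K \<phi> c y \<le> revenue K \<phi> c q"
    using continuous_attains_sup[of Q "revenue K \<phi> c"] z by blast
  have "revenue K \<phi> c y \<le> revenue K \<phi> c q" if "y \<in> admissible L U l u" for y
    using improve[OF that] improve[OF z] q(2) by (meson linear order_refl order_trans)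
  then show ?thesis using that q(1) Q by blast
qed

end

section \<open>The conic constraints of one product\<close>

context separated_bounds
begin

text \<open>
  For \<open>d > 0\<close>, the cone constraint leaves the prices \<open>v / d\<close> with a total of at most
  \<open>ln (d0 / d)\<close>; raising them to that total gains revenue unless the constraint is tight.
  For \<open>d = 0\<close>, the product contributes nothing positive although it could earn something
  positive. So each conic point is dominated by prices, strictly unless it comes from prices.
\<close>

lemma conic_contribution_dominated:
  assumes d0: "0 < d0" and cone: "(d0, d, sum v K) \<in> exp_cone"
    and top: "U = K \<Longrightarrow> (d, d0, - (\<Sum>k\<in>K. u k * d0)) \<in> exp_cone"
    and L: "\<And>k. k \<in> L \<Longrightarrow> l k * d \<le> v k" and U: "\<And>k. k \<in> U \<Longrightarrow> v k \<le> u k * d"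
  obtains y where "y \<in> admissible L U l u"
    "(\<Sum>k\<in>K. \<phi> k * v k) - c * d \<le> d0 * revenue K \<phi> c y"
    "(\<Sum>k\<in>K. \<phi> k * v k) - c * d = d0 * revenue K \<phi> c y
      \<Longrightarrow> 0 < d \<and> d = d0 * exp (- (\<Sum>k\<in>K. v k / d))"
proof (cases "d = 0")
  case True
  then have "U \<noteq> K" using top d0 by (auto simp: exp_cone_def)
  then obtain y where y: "y \<in> admissible L U l u" "0 < revenue K \<phi> c y"
    using positive_revenue by blast
  have "(\<Sum>k\<in>K. \<phi> k * v k) \<le> 0"
    using recession_value_nonpos[of v] L U True cone by (auto simp: exp_cone_def)
  moreover have "0 < d0 * revenue K \<phi> c y" using y(2) d0 by simp
  ultimately show ?thesis using that[OF y(1)] True by simp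
next
  case False
  then have d: "0 < d" "sum v K \<le> d * ln (d0 / d)" using cone by (auto simp: exp_cone_def)
  define x where "x k = v k / d" for k
  define s where "s = ln (d0 / d)"
  have v: "v k = d * x k" for k using d(1) by (simp add: x_def)
  have x: "x \<in> admissible L U l u"
    using L U d(1) by (simp add: admissible_def x_def field_simps)
  have "sum x K = sum v K / d" by (simp add: x_def sum_divide_distrib)
  then have xs: "sum x K \<le> s" using d by (simp add: s_def pos_divide_le_eq mult.commute)
  have su: "s \<le> sum u K" if "U = K"
  proof -
    have "- (sum u K * d0) \<le> d0 * ln (d / d0)"
      using top[OF that] d0 by (simp add: exp_cone_def sum_distrib_right)
    then have "d0 * (- sum u K) \<le> d0 * ln (d / d0)" by (simp add: mult.commute)
    then have "- sum u K \<le> ln (d / d0)" using d0 by (simp only: mult_le_cancel_left_pos)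
    then show ?thesis using d0 d(1) by (simp add: s_def ln_div)
  qed
  obtain y where y: "y \<in> admissible L U l u" "\<And>k. k \<in> K \<Longrightarrow> x k \<le> y k" "sum y K = s"
    using raise_to_sum[OF x xs su] by blast
  have e: "d0 * exp (- s) = d" using d0 d(1) by (simp add: s_def exp_minus)
  have "d0 * revenue K \<phi> c y = ((\<Sum>k\<in>K. \<phi> k * y k) - c) * (d0 * exp (- s))"
    by (simp add: revenue_def y(3))
  then have rev: "d0 * revenue K \<phi> c y = d * (\<Sum>k\<in>K. \<phi> k * y k) - c * d"
    by (simp add: e algebra_simps)
  have val: "(\<Sum>k\<in>K. \<phi> k * v k) = d * (\<Sum>k\<in>K. \<phi> k * x k)"
    by (simp add: v sum_distrib_left mult_ac)
  have nonneg: "0 \<le> \<phi> k * (y k - x k)" if "k \<in> K" for k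
    using y(2)[OF that] pos[OF that] by simp
  have diff: "(\<Sum>k\<in>K. \<phi> k * y k) - (\<Sum>k\<in>K. \<phi> k * x k) = (\<Sum>k\<in>K. \<phi> k * (y k - x k))"
    by (simp add: right_diff_distrib sum_subtractf)
  show ?thesis
  proof (rule that[OF y(1)])
    have "(\<Sum>k\<in>K. \<phi> k * x k) \<le> (\<Sum>k\<in>K. \<phi> k * y k)"
      using diff sum_nonneg[of K "\<lambda>k. \<phi> k * (y k - x k)"] nonneg by simp
    then show "(\<Sum>k\<in>K. \<phi> k * v k) - c * d \<le> d0 * revenue K \<phi> c y"
      using d(1) by (simp add: rev val)
    assume "(\<Sum>k\<in>K. \<phi> k * v k) - c * d = d0 * revenue K \<phi> c y"
    then have "(\<Sum>k\<in>K. \<phi> k * (y k - x k)) = 0" using d(1) diff by (simp add: rev val)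
    then have "\<forall>k\<in>K. \<phi> k * (y k - x k) = 0"
      using sum_nonneg_eq_0_iff[OF fin, of "\<lambda>k. \<phi> k * (y k - x k)"] nonneg by blast
    then have "y k = x k" if "k \<in> K" for k using pos[OF that] that by force
    then have "sum x K = s" using y(3) by simp
    then show "0 < d \<and> d = d0 * exp (- (\<Sum>k\<in>K. v k / d))"
      using e d(1) by (simp add: x_def)
  qed
qed

end

section \<open>All products\<close>

locale assortment =
  fixes J :: "'j set" and K KL KU :: "'j \<Rightarrow> 'k set"
    and xl xu :: "'j \<Rightarrow> 'k \<Rightarrow> real" and \<phi> :: "'k \<Rightarrow> real" and \<psi> :: "'j \<Rightarrow> real"
  assumes finJ: "finite J"
    and bounds: "\<And>j. j \<in> J \<Longrightarrow> attribute_bounds (K j) (KL j) (KU j) (xl j) (xu j) \<phi>"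
begin

abbreviation "F1 \<equiv> SP1_feasible J K KL KU xl xu"
abbreviation "f1 \<equiv> SP1_objective J K \<phi> \<psi>"
abbreviation "F5 \<equiv> SP5_feasible J K KL KU xl xu"
abbreviation "f5 \<equiv> SP5_objective J K \<phi> \<psi>"

definition prices :: "('j \<Rightarrow> 'k \<Rightarrow> real) set" where
  "prices = {x. \<forall>j\<in>J. x j \<in> admissible (KL j) (KU j) (xl j) (xu j)}"

definition total_revenue :: "('j \<Rightarrow> 'k \<Rightarrow> real) \<Rightarrow> real" where
  "total_revenue x = (\<Sum>j\<in>J. revenue (K j) \<phi> (\<psi> j) (x j))"

definition total_weight :: "('j \<Rightarrow> 'k \<Rightarrow> real) \<Rightarrow> real" where
  "total_weight x = 1 + (\<Sum>j\<in>J. exp (- sum (x j) (K j)))"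

lemma total_weight_ge_1: "1 \<le> total_weight x"
  by (simp add: total_weight_def sum_nonneg)

lemma prices_nonempty: "prices \<noteq> {}"
proof -
  have "(\<lambda>j. SOME y. y \<in> admissible (KL j) (KU j) (xl j) (xu j)) \<in> prices"
    unfolding prices_def mem_Collect_eq some_in_eq
    using attribute_bounds.admissible_nonempty[OF bounds] by (intro ballI)
  then show ?thesis by blast
qed

lemma SP1_feasible_iff:
  "(d, x) \<in> F1 \<longleftrightarrow> x \<in> prices \<and> (\<forall>j\<in>J. d j = exp (- sum (x j) (K j)) / total_weight x)"
  by (auto simp: SP1_feasible_def prices_def admissible_def total_weight_def)

text \<open>
  Writing the objective as a quotient makes the first program an instance of fractional
  maximization over the admissible prices.
\<close>

lemma SP1_objective_eq:
  assumes "(d, x) \<in> F1"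
  shows "f1 (d, x) = total_revenue x / total_weight x"
  using assms
  by (simp add: SP1_feasible_iff SP1_objective_def total_revenue_def revenue_def sum_divide_distrib)

lemma prices_SP1_feasible:
  "x \<in> prices \<Longrightarrow> (\<lambda>j. exp (- sum (x j) (K j)) / total_weight x, x) \<in> F1"
  by (simp add: SP1_feasible_iff)

text \<open>
  The substitution \<open>v j k = x j k * d j\<close> embeds the first program into the second one.
\<close>

lemma prices_SP5_feasible:
  assumes x: "x \<in> prices"
  obtains s where "s \<in> F5" "f5 s = total_revenue x / total_weight x"
proof -
  define d0 where "d0 = 1 / total_weight x"
  define d where "d j = d0 * exp (- sum (x j) (K j))" for j
  have d0: "0 < d0" using total_weight_ge_1[of x] by (simp add: d0_def)
  have d: "0 < d j" for j using d0 by (simp add: d_def)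
  have adm: "x j \<in> admissible (KL j) (KU j) (xl j) (xu j)" if "j \<in> J" for j
    using x that by (simp add: prices_def)
  have cone: "(d0, d j, \<Sum>k\<in>K j. x j k * d j) \<in> exp_cone"
      "KU j = K j \<Longrightarrow> (d j, d0, - (\<Sum>k\<in>K j. xu j k * d0)) \<in> exp_cone" if "j \<in> J" for j
    using attribute_bounds.prices_in_exp_cone[OF bounds adm d0 d_def] that by blast+
  have box: "k \<in> KL j \<Longrightarrow> xl j k * d j \<le> x j k * d j" "k \<in> KU j \<Longrightarrow> x j k * d j \<le> xu j k * d j"
    if "j \<in> J" for j k
    using adm[OF that] d[of j] by (auto simp: admissible_def)
  have "d0 + sum d J = d0 * total_weight x"
    by (simp add: d_def total_weight_def algebra_simps sum_distrib_left)
  then have one: "d0 + sum d J = 1" using total_weight_ge_1[of x] by (simp add: d0_def)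
  show ?thesis
  proof (rule that[of "(d, d0, \<lambda>j k. x j k * d j)"])
    show "(d, d0, \<lambda>j k. x j k * d j) \<in> F5"
      unfolding SP5_feasible_def fully_upper_bounded_def mem_Collect_eq prod.case
      using cone box one by blast
    show "f5 (d, d0, \<lambda>j k. x j k * d j) = total_revenue x / total_weight x"
      unfolding SP5_objective_def total_revenue_def prod.case sum_divide_distrib
    proof (rule sum.cong[OF refl])
      fix j
      have "(\<Sum>k\<in>K j. \<phi> k * (x j k * d j)) - \<psi> j * d j = ((\<Sum>k\<in>K j. \<phi> k * x j k) - \<psi> j) * d j"
        by (simp add: algebra_simps sum_distrib_left)
      then show "(\<Sum>k\<in>K j. \<phi> k * (x j k * d j)) - \<psi> j * d j = revenue (K j) \<phi> (\<psi> j) (x j) / total_weight x"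
        by (simp add: revenue_def d_def d0_def)
    qed
  qed
qed

text \<open>
  Raising \<open>k1\<close> and lowering \<open>k2\<close> by the same amount keeps all choice probabilities and
  changes the margin of the product by \<open>\<phi> k1 - \<phi> k2\<close> per unit.
\<close>

lemma SP1_unbounded:
  assumes j: "j \<in> J" and k: "k1 \<in> K j - KU j" "k2 \<in> K j - KL j" "\<phi> k2 < \<phi> k1"
  shows "unbounded_problem F1 f1"
proof -
  interpret attribute_bounds "K j" "KL j" "KU j" "xl j" "xu j" \<phi> by (rule bounds[OF j])
  obtain x where x: "x \<in> prices" using prices_nonempty by blast
  define z where "z t = x(j := (x j)(k1 := x j k1 + t, k2 := x j k2 - t))" for t
  have neq: "k1 \<noteq> k2" using k(3) by auto
  have zp: "z t \<in> prices" if "0 \<le> t" for t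
  proof -
    have "x j \<in> admissible (KL j) (KU j) (xl j) (xu j)" using x j by (simp add: prices_def)
    then have "(x j)(k1 := x j k1 + t, k2 := x j k2 - t) \<in> admissible (KL j) (KU j) (xl j) (xu j)"
      using that k(1,2) neq by (force simp: admissible_def)
    then show ?thesis using x by (simp add: prices_def z_def)
  qed
  have shift: "(\<Sum>k\<in>K j. g k * z t j k) = (\<Sum>k\<in>K j. g k * x j k) + t * (g k1 - g k2)" for t g
  proof -
    have "(\<Sum>k\<in>K j. g k * z t j k)
      = (\<Sum>k\<in>K j. g k * x j k + (if k = k1 then g k1 * t else 0) + (if k = k2 then - (g k2 * t) else 0))"
      using neq by (intro sum.cong) (auto simp: z_def algebra_simps)
    then show ?thesis using fin k by (simp add: sum.distrib algebra_simps)
  qed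
  have sums: "sum (z t i) (K i) = sum (x i) (K i)" for t i
    using shift[of "\<lambda>_. 1" t] by (cases "i = j") (auto simp: z_def)
  then have w: "total_weight (z t) = total_weight x" for t by (simp add: total_weight_def)
  define b where "b = (\<phi> k1 - \<phi> k2) * exp (- sum (x j) (K j)) / total_weight x"
  have b: "0 < b" using k(3) total_weight_ge_1[of x] by (simp add: b_def)
  have "revenue (K i) \<phi> (\<psi> i) (z t i)
      = revenue (K i) \<phi> (\<psi> i) (x i) + (if i = j then t * b * total_weight x else 0)" for t i
  proof (cases "i = j")
    case True
    have "t * b * total_weight x = t * (\<phi> k1 - \<phi> k2) * exp (- sum (x j) (K j))"
      using total_weight_ge_1[of x] by (simp add: b_def)
    then show ?thesis
      unfolding True revenue_def sums shift by (simp add: algebra_simps)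
  qed (simp add: z_def)
  then have "total_revenue (z t) = total_revenue x + t * b * total_weight x" for t
    using finJ j by (simp add: total_revenue_def sum.distrib)
  then have val: "total_revenue (z t) / total_weight (z t) = total_revenue x / total_weight x + t * b" for t
    using total_weight_ge_1[of x] by (simp add: w add_divide_distrib)
  have "\<not> bdd_above (f1 ` F1)"
  proof
    assume "bdd_above (f1 ` F1)"
    then obtain B where B: "f1 s \<le> B" if "s \<in> F1" for s by (auto simp: bdd_above_def)
    have le: "total_revenue x / total_weight x + t * b \<le> B" if "0 \<le> t" for t
      using B[OF prices_SP1_feasible[OF zp[OF that]]] SP1_objective_eq[OF prices_SP1_feasible[OF zp[OF that]]] val
      by simp
    define t where "t = (\<bar>B - total_revenue x / total_weight x\<bar> + 1) / b"
    have "0 \<le> t" "t * b = \<bar>B - total_revenue x / total_weight x\<bar> + 1" using b by (auto simp: t_def)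
    then show False using le[of t] by linarith
  qed
  then show ?thesis using prices_SP1_feasible[OF x] by (auto simp: unbounded_problem_def)
qed

end

locale separated_assortment = assortment +
  fixes \<mu> :: "'a \<Rightarrow> real"
  assumes separated: "\<And>j. j \<in> J \<Longrightarrow> separated_bounds (K j) (KL j) (KU j) (xl j) (xu j) \<phi> (\<mu> j)"
begin

text \<open>
  For fixed \<open>r\<close>, the problem of maximizing \<open>total_revenue x - r * total_weight x\<close> splits into
  one problem per product, in which \<open>r\<close> acts as an additional unit cost.
\<close>

lemma revenue_minus_weight:
  "total_revenue x - r * total_weight x = (\<Sum>j\<in>J. revenue (K j) \<phi> (\<psi> j + r) (x j)) - r"
  by (simp add: total_revenue_def total_weight_def revenue_def algebra_simps sum.distrib
      sum_subtractf sum_distrib_left)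

lemma optimal_prices:
  obtains r x where "x \<in> prices" "total_revenue x = r * total_weight x"
    "\<And>y. y \<in> prices \<Longrightarrow> total_revenue y \<le> r * total_weight y"
proof -
  have "\<exists>x\<in>prices. \<forall>y\<in>prices.
      total_revenue y - r * total_weight y \<le> total_revenue x - r * total_weight x" for r
  proof -
    have "\<forall>j\<in>J. \<exists>x. x \<in> admissible (KL j) (KU j) (xl j) (xu j) \<and>
      (\<forall>y \<in> admissible (KL j) (KU j) (xl j) (xu j).
        revenue (K j) \<phi> (\<psi> j + r) y \<le> revenue (K j) \<phi> (\<psi> j + r) x)"
      using separated_bounds.revenue_attains_max[OF separated] by metis
    then obtain x where x: "\<forall>j\<in>J. x j \<in> admissible (KL j) (KU j) (xl j) (xu j) \<and>
      (\<forall>y \<in> admissible (KL j) (KU j) (xl j) (xu j).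
        revenue (K j) \<phi> (\<psi> j + r) y \<le> revenue (K j) \<phi> (\<psi> j + r) (x j))"
      by metis
    show ?thesis
      using x by (intro bexI[of _ x]) (auto simp: revenue_minus_weight prices_def intro!: sum_mono)
  qed
  then show ?thesis
    by (rule fractional_maximum_parameter[OF prices_nonempty total_weight_ge_1]) (rule that)
qed

text \<open>
  Summing the bounds for the single products gives \<open>f5 (d, d0, v) - r * (1 - d0) \<le> d0 * r\<close>. If
  the value \<open>r\<close> is reached, each of these bounds is an equality, hence each product has
  positive demand, given by its prices.
\<close>

lemma SP5_value_bound:
  assumes r: "\<And>y. y \<in> prices \<Longrightarrow> total_revenue y \<le> r * total_weight y"
    and F: "(d, d0, v) \<in> F5"
  shows "f5 (d, d0, v) \<le> r"
    and "f5 (d, d0, v) = r \<Longrightarrow> j \<in> J \<Longrightarrow> 0 < d j \<and> d j = d0 * exp (- (\<Sum>k\<in>K j. v j k / d j))"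
proof -
  have one: "d0 + sum d J = 1" and cone: "\<And>j. j \<in> J \<Longrightarrow> (d0, d j, sum (v j) (K j)) \<in> exp_cone"
    and top: "\<And>j. j \<in> J \<Longrightarrow> KU j = K j \<Longrightarrow> (d j, d0, - (\<Sum>k\<in>K j. xu j k * d0)) \<in> exp_cone"
    and L: "\<And>j k. j \<in> J \<Longrightarrow> k \<in> KL j \<Longrightarrow> xl j k * d j \<le> v j k"
    and U: "\<And>j k. j \<in> J \<Longrightarrow> k \<in> KU j \<Longrightarrow> v j k \<le> xu j k * d j"
    using F unfolding SP5_feasible_def fully_upper_bounded_def mem_Collect_eq prod.case by simp_all
  have d0: "0 < d0"
  proof (rule ccontr)
    assume "\<not> 0 < d0"
    then have "d j = 0" if "j \<in> J" for j using cone[OF that] by (auto simp: exp_cone_def)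
    then show False using one \<open>\<not> 0 < d0\<close> by simp
  qed
  \<comment> \<open>The contribution of a product when \<open>r\<close> is charged for each unit of demand.\<close>
  define a where "a j = (\<Sum>k\<in>K j. \<phi> k * v j k) - (\<psi> j + r) * d j" for j
  have "\<forall>j\<in>J. \<exists>y. y \<in> admissible (KL j) (KU j) (xl j) (xu j) \<and>
    a j \<le> d0 * revenue (K j) \<phi> (\<psi> j + r) y \<and>
    (a j = d0 * revenue (K j) \<phi> (\<psi> j + r) y \<longrightarrow>
      0 < d j \<and> d j = d0 * exp (- (\<Sum>k\<in>K j. v j k / d j)))"
  proof
    fix j assume j: "j \<in> J"
    show "\<exists>y. y \<in> admissible (KL j) (KU j) (xl j) (xu j) \<and>
      a j \<le> d0 * revenue (K j) \<phi> (\<psi> j + r) y \<and>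
      (a j = d0 * revenue (K j) \<phi> (\<psi> j + r) y \<longrightarrow>
        0 < d j \<and> d j = d0 * exp (- (\<Sum>k\<in>K j. v j k / d j)))"
      by (rule separated_bounds.conic_contribution_dominated
          [OF separated[OF j] d0 cone[OF j] top[OF j] L[OF j] U[OF j], where c = "\<psi> j + r"])
        (auto simp: a_def)
  qed
  then obtain y where y: "\<And>j. j \<in> J \<Longrightarrow> y j \<in> admissible (KL j) (KU j) (xl j) (xu j)"
    "\<And>j. j \<in> J \<Longrightarrow> a j \<le> d0 * revenue (K j) \<phi> (\<psi> j + r) (y j)"
    "\<And>j. j \<in> J \<Longrightarrow> a j = d0 * revenue (K j) \<phi> (\<psi> j + r) (y j) \<Longrightarrow>
      0 < d j \<and> d j = d0 * exp (- (\<Sum>k\<in>K j. v j k / d j))"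
    by metis
  have "sum a J = f5 (d, d0, v) - r * sum d J"
    by (simp add: a_def SP5_objective_def algebra_simps sum.distrib sum_subtractf sum_distrib_left)
  moreover have "sum d J = 1 - d0" using one by simp
  ultimately have val: "f5 (d, d0, v) = r + (sum a J - d0 * r)" by (simp add: algebra_simps)
  have "total_revenue y \<le> r * total_weight y" using r y(1) by (simp add: prices_def)
  then have "(\<Sum>j\<in>J. revenue (K j) \<phi> (\<psi> j + r) (y j)) \<le> r"
    using revenue_minus_weight[of y r] by linarith
  then have "d0 * (\<Sum>j\<in>J. revenue (K j) \<phi> (\<psi> j + r) (y j)) \<le> d0 * r" using d0 by simp
  then have rev: "(\<Sum>j\<in>J. d0 * revenue (K j) \<phi> (\<psi> j + r) (y j)) \<le> d0 * r"
    by (simp add: sum_distrib_left)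
  have le: "sum a J \<le> (\<Sum>j\<in>J. d0 * revenue (K j) \<phi> (\<psi> j + r) (y j))"
    using y(2) by (intro sum_mono)
  show "f5 (d, d0, v) \<le> r" using val le rev by linarith
  assume "f5 (d, d0, v) = r" and j: "j \<in> J"
  then have "sum a J = (\<Sum>j\<in>J. d0 * revenue (K j) \<phi> (\<psi> j + r) (y j))"
    using val le rev by linarith
  then have "a j = d0 * revenue (K j) \<phi> (\<psi> j + r) (y j)"
    using sum_mono_inv[of a J "\<lambda>j. d0 * revenue (K j) \<phi> (\<psi> j + r) (y j)" j] y(2) j finJ by blast
  then show "0 < d j \<and> d j = d0 * exp (- (\<Sum>k\<in>K j. v j k / d j))" using y(3) j by blast
qed

text \<open>
  The normalization \<open>d0 + sum d J = 1\<close> turns the demands relative to the outside option into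
  the choice probabilities.
\<close>

lemma SP5_tight_gives_SP1:
  assumes F: "(d, d0, v) \<in> F5"
    and d: "\<And>j. j \<in> J \<Longrightarrow> 0 < d j \<and> d j = d0 * exp (- (\<Sum>k\<in>K j. v j k / d j))"
  shows "(d, \<lambda>j k. v j k / d j) \<in> F1" "f1 (d, \<lambda>j k. v j k / d j) = f5 (d, d0, v)"
proof -
  define x where "x = (\<lambda>j k. v j k / d j)"
  have one: "d0 + sum d J = 1" and L: "\<And>j k. j \<in> J \<Longrightarrow> k \<in> KL j \<Longrightarrow> xl j k * d j \<le> v j k"
    and U: "\<And>j k. j \<in> J \<Longrightarrow> k \<in> KU j \<Longrightarrow> v j k \<le> xu j k * d j"
    using F unfolding SP5_feasible_def mem_Collect_eq prod.case by simp_all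
  have dx: "d j = d0 * exp (- sum (x j) (K j))" if "j \<in> J" for j
    using d[OF that] by (simp add: x_def)
  have "d0 * total_weight x = d0 + sum d J"
    by (simp add: total_weight_def algebra_simps sum_distrib_left dx cong: sum.cong)
  then have "d0 = 1 / total_weight x" using one total_weight_ge_1[of x] by (simp add: field_simps)
  then have "d j = exp (- sum (x j) (K j)) / total_weight x" if "j \<in> J" for j
    using dx[OF that] by simp
  moreover have "x \<in> prices"
    using L U d by (simp add: prices_def admissible_def x_def field_simps)
  ultimately show "(d, \<lambda>j k. v j k / d j) \<in> F1" by (simp add: SP1_feasible_iff x_def)
  show "f1 (d, \<lambda>j k. v j k / d j) = f5 (d, d0, v)"
    unfolding SP1_objective_def SP5_objective_def prod.case
  proof (rule sum.cong[OF refl])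
    fix j assume "j \<in> J"
    then have "d j \<noteq> 0" using d by force
    then show "((\<Sum>k\<in>K j. \<phi> k * (v j k / d j)) - \<psi> j) * d j = (\<Sum>k\<in>K j. \<phi> k * v j k) - \<psi> j * d j"
      by (simp add: left_diff_distrib sum_distrib_right)
  qed
qed

lemma SP1_SP5_optimal:
  shows "\<exists>s. is_optimal F1 f1 s" and "\<exists>s. is_optimal F5 f5 s"
    and "is_optimal F5 f5 (d, d0, v) \<Longrightarrow>
      (\<forall>j\<in>J. 0 < d j) \<and> is_optimal F1 f1 (d, \<lambda>j k. v j k / d j)"
proof -
  obtain r x where x: "x \<in> prices" "total_revenue x = r * total_weight x"
    and r: "\<And>y. y \<in> prices \<Longrightarrow> total_revenue y \<le> r * total_weight y"
    using optimal_prices by blast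
  have quot: "total_revenue x / total_weight x = r" using x(2) total_weight_ge_1[of x] by simp
  have le1: "f1 s \<le> r" if "s \<in> F1" for s
  proof -
    obtain d y where s: "s = (d, y)" by fastforce
    then have "y \<in> prices" using that SP1_feasible_iff by blast
    then have "total_revenue y / total_weight y \<le> r"
      using r[of y] total_weight_ge_1[of y] by (simp add: pos_divide_le_eq)
    then show ?thesis using SP1_objective_eq[of d y] that unfolding s by simp
  qed
  show "\<exists>s. is_optimal F1 f1 s"
  proof (intro exI)
    let ?s = "(\<lambda>j. exp (- sum (x j) (K j)) / total_weight x, x)"
    have "?s \<in> F1" by (rule prices_SP1_feasible[OF x(1)])
    moreover from this have "f1 ?s = r" using SP1_objective_eq quot by simp
    ultimately show "is_optimal F1 f1 ?s" using le1 by (simp add: is_optimal_def)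
  qed
  obtain s where s: "s \<in> F5" "f5 s = r"
    by (rule prices_SP5_feasible[OF x(1)]) (simp add: quot)
  have le5: "f5 t \<le> r" if "t \<in> F5" for t
    using SP5_value_bound(1)[OF r, of "fst t" "fst (snd t)" "snd (snd t)"] that by simp
  have "is_optimal F5 f5 s" using s le5 by (simp add: is_optimal_def)
  then show "\<exists>s. is_optimal F5 f5 s" by blast
  \<comment> \<open>Both programs have the value \<open>r\<close>, so an optimal conic point attains the bound.\<close>
  assume "is_optimal F5 f5 (d, d0, v)"
  then have F: "(d, d0, v) \<in> F5" and "f5 (d, d0, v) = r"
    using s le5[of "(d, d0, v)"] unfolding is_optimal_def by (blast, force)
  then have d: "\<And>j. j \<in> J \<Longrightarrow> 0 < d j \<and> d j = d0 * exp (- (\<Sum>k\<in>K j. v j k / d j))"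
    using SP5_value_bound(2)[OF r F] by blast
  show "(\<forall>j\<in>J. 0 < d j) \<and> is_optimal F1 f1 (d, \<lambda>j k. v j k / d j)"
    using SP5_tight_gives_SP1[OF F d] d le1 \<open>f5 (d, d0, v) = r\<close> unfolding is_optimal_def by auto
qed

end

section \<open>The dichotomy\<close>

lemma optimal_not_unbounded: "is_optimal F f s \<Longrightarrow> \<not> unbounded_problem F f"
  by (auto simp: is_optimal_def unbounded_problem_def bdd_above_def)

theorem theorem3p3:
  fixes J :: "'j set" and K KL KU :: "'j \<Rightarrow> 'k set"
    and xl xu :: "'j \<Rightarrow> 'k \<Rightarrow> real" and \<phi> :: "'k \<Rightarrow> real" and \<psi> :: "'j \<Rightarrow> real"
  assumes "finite J" and "J \<noteq> {}"
    and "\<And>j. j \<in> J \<Longrightarrow> finite (K j)" and "\<And>j. j \<in> J \<Longrightarrow> K j \<noteq> {}"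
    and "\<And>j. j \<in> J \<Longrightarrow> KL j \<subseteq> K j" and "\<And>j. j \<in> J \<Longrightarrow> KU j \<subseteq> K j"
    and "\<And>j k. j \<in> J \<Longrightarrow> k \<in> KL j \<inter> KU j \<Longrightarrow> xl j k \<le> xu j k"
    and "\<And>k. k \<in> (\<Union>j\<in>J. K j) \<Longrightarrow> \<phi> k > 0"
  defines "F1 \<equiv> SP1_feasible J K KL KU xl xu" and "f1 \<equiv> SP1_objective J K \<phi> \<psi>"
    and "F5 \<equiv> SP5_feasible J K KL KU xl xu" and "f5 \<equiv> SP5_objective J K \<phi> \<psi>"
    and "C \<equiv> (\<forall>j\<in>J. \<forall>k1\<in>K j - KU j. \<forall>k2\<in>K j - KL j. \<phi> k1 \<le> \<phi> k2)"
  shows "((\<exists>s. is_optimal F1 f1 s) \<longleftrightarrow> C) \<and>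
    (C \<longrightarrow>
      (\<exists>s. is_optimal F5 f5 s) \<and>
      (\<forall>d d0 u. is_optimal F5 f5 (d, d0, u) \<longrightarrow>
        (\<forall>j\<in>J. d j > 0) \<and> is_optimal F1 f1 (d, \<lambda>j k. u j k / d j))) \<and>
    (\<not> C \<longrightarrow> unbounded_problem F1 f1)"
proof -
  interpret assortment J K KL KU xl xu \<phi> \<psi>
  proof (rule assortment.intro)
    show "attribute_bounds (K j) (KL j) (KU j) (xl j) (xu j) \<phi>" if j: "j \<in> J" for j
      using assms(8) j by (intro attribute_bounds.intro assms(3-7)) auto
  qed (rule assms(1))
  have unb: "unbounded_problem F1 f1" if "\<not> C"
    using that SP1_unbounded unfolding C_def F1_def f1_def by (meson not_le)
  show ?thesis
  proof (cases C)
    case True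
    have "\<forall>j\<in>J. \<exists>\<mu>. 0 < \<mu> \<and> (\<forall>k\<in>K j - KU j. \<phi> k \<le> \<mu>) \<and> (\<forall>k\<in>K j - KL j. \<mu> \<le> \<phi> k)"
      using attribute_bounds.ordered_bounds_separated[OF bounds] True unfolding C_def by blast
    then obtain \<mu> where mu: "\<forall>j\<in>J. 0 < \<mu> j \<and> (\<forall>k\<in>K j - KU j. \<phi> k \<le> \<mu> j) \<and>
        (\<forall>k\<in>K j - KL j. \<mu> j \<le> \<phi> k)"
      by metis
    interpret separated_assortment J K KL KU xl xu \<phi> \<psi> \<mu>
    proof (intro separated_assortment.intro separated_assortment_axioms.intro)
      show "separated_bounds (K j) (KL j) (KU j) (xl j) (xu j) \<phi> (\<mu> j)" if "j \<in> J" for j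
        using mu that by (intro separated_bounds.intro separated_bounds_axioms.intro bounds) auto
    qed (rule assortment_axioms)
    show ?thesis
      using True SP1_SP5_optimal unfolding F1_def f1_def F5_def f5_def by blast
  next
    case False
    then have "unbounded_problem F1 f1" by (rule unb)
    moreover from this have "\<nexists>s. is_optimal F1 f1 s"
      using optimal_not_unbounded[of F1 f1] by blast
    ultimately show ?thesis using False by simp
  qed
qed

end
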